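(* Let $b$ be a prime, $\alpha,s,m\in\mathbb{N}$ with $\alpha\ge2$, and let $p\in\mathbb{F}_b[x]$ with $\deg(p)=m$ be irreducible. For a set of weights $\boldsymbol{\gamma}=(\gamma_u)_{u\subset\mathbb{N}}$ (non-negative reals), there exists at least one $\boldsymbol{q}^*=(q_1^*,\ldots,q_s^* )\in(G^*_{b,m})^s$ such that $$B_{\boldsymbol{\gamma}}(p,\boldsymbol{q}^* )\le\frac{1}{(b^m-1)^{1/\lambda}}\left[\sum_{\emptyset\ne u\subseteq\{1,\ldots,s\}}\gamma_u^\lambda C_\alpha^{\lambda|u|}E_{\alpha,\lambda}^{|u|}\right]^{1/\lambda}$$ holds for any $1/\alpha<\lambda\le1$.
   Context: $\mathbb{F}_b$ is identified with $\{0,\ldots,b-1\}$. $G_{b,m}=\{q\in\mathbb{F}_b[x]:\deg q<m\}$, $G_{b,m}^*=G_{b,m}\setminus\{0\}$. For $k\in\mathbb{N}_0$ with $b$-adic expansion $k=\kappa_0+\kappa_1b+\cdots$, $\mathrm{tr}_m(k)=\kappa_0+\kappa_1x+\cdots+\kappa_{m-1}x^{m-1}\in G_{b,m}$ (applied componentwise to vectors). For $p\in\mathbb{F}_b[x]$ with $\deg p=m$ and $\boldsymbol{q}\in(G_{b,m}^* )^s$, the dual polynomial lattice is $P^\perp(p,\boldsymbol{q})=\{\boldsymbol{k}\in\mathbb{N}_0^s:\mathrm{tr}_m(\boldsymbol{k})\cdot\boldsymbol{q}\equiv0\pmod p\}$, and for $\emptyset\ne u\subseteq\{1,\ldots,s\}$,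 $P_u^\perp(p,\boldsymbol{q})=\{\boldsymbol{k}_u\in\mathbb{N}^{|u|}:(\boldsymbol{k}_u,\boldsymbol{0})\in P^\perp(p,\boldsymbol{q})\}$, where $(\boldsymbol{k}_u,\boldsymbol{0})$ has components $k_j$ for $j\in u$ and $0$ otherwise. For $k=\kappa_1b^{a_1-1}+\cdots+\kappa_vb^{a_v-1}\in\mathbb{N}$ with $a_1>\cdots>a_v>0$ and $\kappa_i\in\{1,\ldots,b-1\}$, $\mu_\alpha(k)=a_1+\cdots+a_{\min(v,\alpha)}$; $\mu_\alpha(0)=0$; for vectors $\mu_\alpha(\boldsymbol{k})=\sum_j\mu_\alpha(k_j)$. The quality criterion is $$B_{\boldsymbol{\gamma}}(p,\boldsymbol{q})=\sum_{\emptyset\ne u\subseteq\{1,\ldots,s\}}\gamma_uC_\alpha^{|u|}\sum_{\substack{\boldsymbol{k}_u\in P_u^\perp(p,\boldsymbol{q})\\ \exists j\in u:\ b^m\nmid k_j}}b^{-\mu_\alpha(\boldsymbol{k}_u)},\qquad m=\deg(p),$$ with $$C_\alpha=\max\left(\frac{2}{(2\sin\frac{\pi}{b})^\alpha},\max_{1\le z\le\alpha-1}\frac{1}{(2\sin\frac{\pi}{b})^z}\right)\left(1+\frac1b+\frac1{b(b+1)}\right)^{\alpha-2}\left(3+\frac2b+\frac{2b+1}{b-1}\right).$$ For $1/\alpha<\lambda\le1$, $$E_{\alpha,\lambda}=\sum_{k=1}^\infty b^{-\lambda\mu_\alpha(k)}=\sum_{w=1}^{\alpha-1}\prod_{i=1}^w\left(\frac{b-1}{b^{\lambda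 i}-1}\right)+\left(\frac{b^{\lambda\alpha}-1}{b^{\lambda\alpha}-b}\right)\prod_{i=1}^\alpha\left(\frac{b-1}{b^{\lambda i}-1}\right).$$ *)

theory Defs
  imports
    "HOL-Analysis.Analysis"
    "HOL-Number_Theory.Cong"
    "Berlekamp_Zassenhaus.Finite_Field"
begin

text \<open>
  Throughout, the field with \<open>b\<close> elements (\<open>b\<close> prime) is \<open>'b mod_ring\<close> for a type
  \<open>'b\<close> of class \<open>prime_card\<close> with \<open>CARD('b) = b\<close>; a digit \<open>\<kappa> \<in> {0..<b}\<close> is identified
  with \<open>of_nat \<kappa>\<close>. A vector indexed by a set \<open>u\<close> of coordinates is an extensional
  function on \<open>u\<close> (\<open>PiE\<close>), so that each vector is represented exactly once.
\<close>

definition digit :: "nat \<Rightarrow> nat \<Rightarrow> nat \<Rightarrow> nat" where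
  "digit b k i = k div b ^ i mod b"

text \<open>The zero polynomial has degree \<open>-\<infinity>\<close> here, but degree \<open>0\<close> in the library.\<close>

definition G_poly :: "nat \<Rightarrow> 'b::prime_card mod_ring poly set" where
  "G_poly m = {q. q = 0 \<or> degree q < m}"

definition G_star :: "nat \<Rightarrow> 'b::prime_card mod_ring poly set" where
  "G_star m = G_poly m - {0}"

definition tr :: "nat \<Rightarrow> nat \<Rightarrow> 'b::prime_card mod_ring poly" where
  "tr m k = (\<Sum>i<m. Polynomial.monom (of_nat (digit CARD('b) k i)) i)"

definition dual_lattice ::
  "nat \<Rightarrow> 'b::prime_card mod_ring poly \<Rightarrow> (nat \<Rightarrow> 'b mod_ring poly) \<Rightarrow> (nat \<Rightarrow> nat) set" where
  "dual_lattice s p q =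
     {k \<in> {1..s} \<rightarrow>\<^sub>E UNIV. [(\<Sum>j=1..s. tr (degree p) (k j) * q j) = 0] (mod p)}"

definition dual_lattice_proj ::
  "nat \<Rightarrow> nat set \<Rightarrow> 'b::prime_card mod_ring poly \<Rightarrow> (nat \<Rightarrow> 'b mod_ring poly) \<Rightarrow> (nat \<Rightarrow> nat) set" where
  "dual_lattice_proj s u p q =
     {k \<in> u \<rightarrow>\<^sub>E {1..}. (\<lambda>j\<in>{1..s}. if j \<in> u then k j else 0) \<in> dual_lattice s p q}"

text \<open>The exponents \<open>a\<^sub>1 > \<dots> > a\<^sub>v\<close> are the one-based positions of the nonzero digits,
  listed in decreasing order.\<close>

definition digit_positions :: "nat \<Rightarrow> nat \<Rightarrow> nat set" where
  "digit_positions b k = {a. 0 < a \<and> digit b k (a - 1) \<noteq> 0}"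

definition mu :: "nat \<Rightarrow> nat \<Rightarrow> nat \<Rightarrow> nat" where
  "mu b \<alpha> k = sum_list (take \<alpha> (rev (sorted_list_of_set (digit_positions b k))))"

definition mu_vec :: "nat \<Rightarrow> nat \<Rightarrow> nat set \<Rightarrow> (nat \<Rightarrow> nat) \<Rightarrow> nat" where
  "mu_vec b \<alpha> u k = (\<Sum>j\<in>u. mu b \<alpha> (k j))"

definition C_const :: "nat \<Rightarrow> nat \<Rightarrow> real" where
  "C_const b \<alpha> =
     max (2 / (2 * sin (pi / real b)) ^ \<alpha>)
         (Max ((\<lambda>z. 1 / (2 * sin (pi / real b)) ^ z) ` {1..\<alpha> - 1}))
     * (1 + 1 / real b + 1 / (real b * (real b + 1))) ^ (\<alpha> - 2)
     * (3 + 2 / real b + (2 * real b + 1) / (real b - 1))"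

definition E_const :: "nat \<Rightarrow> nat \<Rightarrow> real \<Rightarrow> real" where
  "E_const b \<alpha> l = (\<Sum>\<^sub>\<infinity>k\<in>{1..}. real b powr (- l * real (mu b \<alpha> k)))"

definition B_crit ::
  "nat \<Rightarrow> nat \<Rightarrow> (nat set \<Rightarrow> real) \<Rightarrow> 'b::prime_card mod_ring poly \<Rightarrow> (nat \<Rightarrow> 'b mod_ring poly) \<Rightarrow> real" where
  "B_crit s \<alpha> \<gamma> p q =
     (\<Sum>u\<in>Pow {1..s} - {{}}. \<gamma> u * C_const CARD('b) \<alpha> ^ card u *
        (\<Sum>\<^sub>\<infinity>k\<in>{k \<in> dual_lattice_proj s u p q. \<exists>j\<in>u. \<not> CARD('b) ^ degree p dvd k j}.
           real CARD('b) powr (- real (mu_vec CARD('b) \<alpha> u k))))"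

end

theory Submission
  imports Defs
begin

text \<open>
  The vector \<open>q\<^sup>*\<close> is a minimiser of \<open>B\<close> over the finite set of all admissible generating vectors.
  It does not depend on the exponent \<open>l\<close>, which is why one vector serves every \<open>l\<close> at once. For a
  given \<open>l\<close> the bound comes from averaging: \<open>B(q\<^sup>*)\<^sup>l\<close> is at most the mean of \<open>B(q)\<^sup>l\<close> over all \<open>q\<close>.

  Three facts bound this mean. Since \<open>l \<le> 1\<close>, the map \<open>x \<mapsto> x\<^sup>l\<close> is subadditive, also for infinite
  sums (\<open>infsum_powr_le\<close>), so \<open>B(q)\<^sup>l\<close> is at most the sum obtained by raising every term of \<open>B(q)\<close> to
  the power \<open>l\<close>. In the averaged sum, a vector \<open>k\<close> is then counted once for each \<open>q\<close> whose dual lattice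
  contains it. As some component \<open>k j\<close> is not a multiple of \<open>b\<^sup>m\<close> and \<open>p\<close> is irreducible, the congruence
  defining the dual lattice determines \<open>q j\<close> from the other components of \<open>q\<close>, so \<open>k\<close> is counted for
  at most one in \<open>b\<^sup>m - 1\<close> of the vectors \<open>q\<close> (\<open>card_orthogonal_mult_le\<close>, \<open>card_dual_vectors_mult_le\<close>).
  Finally, the sum over all \<open>k\<close> with positive entries indexed by \<open>u\<close> factorises into \<open>card u\<close> copies of
  \<open>E_const\<close> (\<open>infsum_prod_PiE_const\<close>).

  The analytic point is that the series \<open>E_const\<close> converges for \<open>l > 1 / \<alpha>\<close> (\<open>powr_mu_summable_on\<close>).
  Splitting off the leading digit relates the partial sums of order \<open>\<beta> + 1\<close> to those of order \<open>\<beta>\<close>, and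
  \<open>\<alpha>\<close> such steps bring the trivial bound \<open>b\<^sup>n\<close> for the sum over \<open>k < b\<^sup>n\<close> down to a constant
  (\<open>sum_powr_mu_bound\<close>).
\<close>

section \<open>Truncated digit polynomials\<close>

lemma mod_power_eq_if_digits_eq:
  fixes k k' b m :: nat
  assumes "\<And>i. i < m \<Longrightarrow> digit b k i = digit b k' i"
  shows "k mod b ^ m = k' mod b ^ m"
  using assms
proof (induction m)
  case (Suc m)
  then have "k mod b ^ m = k' mod b ^ m" and "digit b k m = digit b k' m"
    by auto
  then show ?case
    by (simp only: power_Suc2 mod_mult2_eq digit_def)
qed simp

text \<open>Digits lie below the characteristic, so passing from a digit to the field element it is
  identified with loses nothing.\<close>

lemma of_nat_digit_eq_iff:
  "(of_nat (digit CARD('b) k i) :: 'b::prime_card mod_ring) = of_nat (digit CARD('b) k' i)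
     \<longleftrightarrow> digit CARD('b) k i = digit CARD('b) k' i"
proof -
  have inj: "x = y" if "x \<le> y" "y < CARD('b)" "(of_nat x :: 'b mod_ring) = of_nat y" for x y :: nat
  proof -
    have "(of_nat (y - x) :: 'b mod_ring) = 0"
      using that by (simp add: of_nat_diff)
    then have "CARD('b) dvd y - x"
      by (rule of_nat_0_mod_ring_dvd)
    then show ?thesis
      using that by (meson diff_is_0_eq diff_le_self dvd_imp_le le_antisym le_trans not_less
          zero_less_iff_neq_zero)
  qed
  have "digit CARD('b) k i < CARD('b)" "digit CARD('b) k' i < CARD('b)"
    by (simp_all add: digit_def)
  then show ?thesis
    using inj by (metis nat_le_linear)
qed

lemma coeff_tr:
  "poly.coeff (tr m k :: 'b::prime_card mod_ring poly) i =
     (if i < m then of_nat (digit CARD('b) k i) else 0)"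
  by (simp add: tr_def coeff_sum)

lemma tr_0: "tr m 0 = 0"
  by (simp add: tr_def digit_def)

lemma tr_in_G_poly: "(tr m k :: 'b::prime_card mod_ring poly) \<in> G_poly m"
proof (cases "(tr m k :: 'b mod_ring poly) = 0")
  case False
  then have "poly.coeff (tr m k :: 'b mod_ring poly) (degree (tr m k :: 'b mod_ring poly)) \<noteq> 0"
    by simp
  then have "degree (tr m k :: 'b mod_ring poly) < m"
    unfolding coeff_tr by (simp split: if_splits)
  then show ?thesis by (simp add: G_poly_def)
qed (simp add: G_poly_def)

lemma tr_eqD:
  assumes "(tr m k :: 'b::prime_card mod_ring poly) = tr m k'"
  shows "k mod CARD('b) ^ m = k' mod CARD('b) ^ m"
proof (rule mod_power_eq_if_digits_eq)
  fix i assume "i < m"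
  then show "digit CARD('b) k i = digit CARD('b) k' i"
    using arg_cong[OF assms, of "\<lambda>f. poly.coeff f i"]
    by (simp add: coeff_tr of_nat_digit_eq_iff)
qed

lemma tr_eq_0D:
  assumes "(tr m k :: 'b::prime_card mod_ring poly) = 0"
  shows "CARD('b) ^ m dvd k"
  using tr_eqD[of m k 0] assms by (simp add: tr_0 mod_eq_0_iff_dvd)

lemma finite_G_poly: "finite (G_poly m :: 'b::prime_card mod_ring poly set)"
proof (rule finite_subset)
  show "(G_poly m :: 'b mod_ring poly set)
      \<subseteq> Poly ` {xs. set xs \<subseteq> (UNIV :: 'b mod_ring set) \<and> length xs \<le> m}"
  proof
    fix f :: "'b mod_ring poly"
    assume "f \<in> G_poly m"
    then have "length (coeffs f) \<le> m"
      by (cases "f = 0") (auto simp: G_poly_def length_coeffs_degree)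
    then show "f \<in> Poly ` {xs. set xs \<subseteq> (UNIV :: 'b mod_ring set) \<and> length xs \<le> m}"
      by (intro image_eqI[of _ _ "coeffs f"]) auto
  qed
qed (intro finite_imageI finite_lists_length_le finite)

text \<open>Truncation is injective on the numbers below \<open>b\<^sup>m\<close>, so there are at least \<open>b\<^sup>m\<close> polynomials of
  degree below \<open>m\<close>. A lower bound suffices for the averaging argument, where this cardinality only
  occurs as a denominator.\<close>

lemma card_G_star_ge:
  "CARD('b) ^ m - 1 \<le> card (G_star m :: 'b::prime_card mod_ring poly set)"
proof -
  have "inj_on (tr m :: nat \<Rightarrow> 'b mod_ring poly) {..<CARD('b) ^ m}"
    by (rule inj_onI) (auto dest!: tr_eqD)
  then have "CARD('b) ^ m = card ((tr m :: nat \<Rightarrow> 'b mod_ring poly) ` {..<CARD('b) ^ m})"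
    by (simp add: card_image)
  also have "\<dots> \<le> card (G_poly m :: 'b mod_ring poly set)"
    by (rule card_mono[OF finite_G_poly]) (auto simp: tr_in_G_poly)
  finally show ?thesis
    by (simp add: G_star_def G_poly_def)
qed

lemma eq_if_dvd_diff_G_poly:
  fixes f g p :: "'b::prime_card mod_ring poly"
  assumes "f \<in> G_poly (degree p)" "g \<in> G_poly (degree p)" "p dvd f - g"
  shows "f = g"
proof (rule ccontr)
  assume "f \<noteq> g"
  then have "degree p \<le> degree (f - g)"
    using assms(3) by (intro dvd_imp_degree_le) auto
  moreover have "degree (f - g) < degree p"
    using assms(1,2) \<open>f \<noteq> g\<close> by (auto simp: G_poly_def intro: degree_diff_less)
  ultimately show False by simp
qed

section \<open>Counting the vectors orthogonal to a given one\<close>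

text \<open>A linear congruence with a coefficient \<open>t j\<close> that is cancellable modulo \<open>p\<close> determines \<open>q j\<close> modulo \<open>p\<close> from the
  other coordinates. As the elements of \<open>G\<close> are pairwise incongruent, at most one value of \<open>q j\<close>
  completes a given choice of the others. The statement is in product form in order to avoid
  exponents \<open>card I - 1\<close>; accordingly, the proof makes overwriting coordinate \<open>j\<close> by an arbitrary
  element of \<open>G\<close> an injection.\<close>

lemma card_orthogonal_mult_le:
  fixes p :: "'a::comm_ring_1" and t :: "'i \<Rightarrow> 'a"
  assumes "prime_elem p" "finite I" "j \<in> I" "finite G" "\<not> p dvd t j"
    and incong: "\<And>x y. x \<in> G \<Longrightarrow> y \<in> G \<Longrightarrow> p dvd x - y \<Longrightarrow> x = y"
  shows "card {q \<in> I \<rightarrow>\<^sub>E G. p dvd (\<Sum>i\<in>I. t i * q i)} * card G \<le> card G ^ card I"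
proof -
  let ?Z = "{q \<in> I \<rightarrow>\<^sub>E G. p dvd (\<Sum>i\<in>I. t i * q i)}"
  have "inj_on (\<lambda>(q, g). q(j := g)) (?Z \<times> G)"
  proof (rule inj_onI, clarify)
    fix q g q' g'
    assume q: "q \<in> I \<rightarrow>\<^sub>E G" "p dvd (\<Sum>i\<in>I. t i * q i)"
      and q': "q' \<in> I \<rightarrow>\<^sub>E G" "p dvd (\<Sum>i\<in>I. t i * q' i)"
      and eq: "q(j := g) = q'(j := g')"
    have off: "q i = q' i" if "i \<noteq> j" for i
      using fun_cong[OF eq, of i] that by simp
    have "(\<Sum>i\<in>I. t i * q i) - (\<Sum>i\<in>I. t i * q' i) = t j * (q j - q' j)"
      using off assms(2,3)
      by (simp add: sum_subtractf[symmetric] right_diff_distrib[symmetric] sum.remove[of I j])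
    then have "p dvd t j * (q j - q' j)"
      using q(2) q'(2) by (metis dvd_diff)
    then have "p dvd q j - q' j"
      using assms(1,5) prime_elem_dvd_mult_iff by blast
    then have "q j = q' j"
      using incong q(1) q'(1) assms(3) by (auto simp: PiE_iff)
    then have "q = q'"
      using off by (metis ext)
    then show "q = q' \<and> g = g'"
      using fun_cong[OF eq, of j] by simp
  qed
  then have "card ?Z * card G = card ((\<lambda>(q, g). q(j := g)) ` (?Z \<times> G))"
    by (simp add: card_image card_cartesian_product)
  also have "\<dots> \<le> card (I \<rightarrow>\<^sub>E G)"
    using assms(2-4) by (intro card_mono finite_PiE) (auto simp: PiE_iff extensional_def)
  also have "\<dots> = card G ^ card I"
    using assms(2) by (rule card_funcsetE)
  finally show ?thesis .
qed


section \<open>Infinite sums of powers\<close>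

text \<open>The inequality often attributed to Jensen, \<open>(\<Sum> a\<^sub>i)\<^sup>l \<le> \<Sum> a\<^sub>i\<^sup>l\<close> for \<open>0 < l \<le> 1\<close>. Dividing by
  the total sum \<open>S\<close> reduces it to \<open>t \<le> t\<^sup>l\<close> for \<open>t = a\<^sub>i / S\<close> in \<open>[0, 1]\<close>.\<close>

lemma infsum_powr_le:
  fixes f :: "'a \<Rightarrow> real"
  assumes "0 < l" "l \<le> 1"
    and nonneg: "\<And>x. x \<in> A \<Longrightarrow> 0 \<le> f x"
    and summ: "(\<lambda>x. f x powr l) summable_on A"
  shows "(\<Sum>\<^sub>\<infinity>x\<in>A. f x) powr l \<le> (\<Sum>\<^sub>\<infinity>x\<in>A. f x powr l)"
proof (cases "infsum f A = 0")
  case True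
  \<comment> \<open>This case includes an \<open>f\<close> that is not summable, for which \<open>infsum\<close> has the value 0.\<close>
  then show ?thesis
    using assms(1) by (simp add: infsum_nonneg)
next
  case False
  define S where "S = infsum f A"
  have f_summ: "f summable_on A"
    using False infsum_not_exists by blast
  have "S > 0"
    using False infsum_nonneg[of A f] nonneg by (force simp: S_def)
  have le: "f x * (S powr l / S) \<le> f x powr l" if "x \<in> A" for x
  proof -
    have "f x \<le> S"
      using finite_sum_le_infsum[OF f_summ, of "{x}"] that nonneg by (simp add: S_def)
    then have "f x / S \<le> 1" "0 \<le> f x / S"
      using \<open>S > 0\<close> nonneg that by auto
    then have "(f x / S) powr 1 \<le> (f x / S) powr l"
      using assms(2) by (intro powr_mono') auto
    then have "f x / S \<le> f x powr l / S powr l"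
      using \<open>0 \<le> f x / S\<close> \<open>S > 0\<close> nonneg that by (simp add: powr_divide)
    then show ?thesis
      using \<open>S > 0\<close> by (simp add: field_simps)
  qed
  have "S powr l = (\<Sum>\<^sub>\<infinity>x\<in>A. f x * (S powr l / S))"
    using \<open>S > 0\<close> by (subst infsum_cmult_left') (simp add: S_def[symmetric])
  also have "\<dots> \<le> (\<Sum>\<^sub>\<infinity>x\<in>A. f x powr l)"
    using f_summ summ le by (intro infsum_mono summable_on_cmult_left)
  finally show ?thesis by (simp add: S_def)
qed

lemma sum_powr_le:
  fixes f :: "'a \<Rightarrow> real"
  assumes "finite A" "0 < l" "l \<le> 1" "\<And>x. x \<in> A \<Longrightarrow> 0 \<le> f x"
  shows "(\<Sum>x\<in>A. f x) powr l \<le> (\<Sum>x\<in>A. f x powr l)"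
  using infsum_powr_le[of l A f] assms by simp

lemma sum_infsum_swap:
  fixes f :: "'a \<Rightarrow> 'b \<Rightarrow> real"
  assumes "finite Q" "\<And>q. q \<in> Q \<Longrightarrow> f q summable_on A"
  shows "(\<Sum>q\<in>Q. \<Sum>\<^sub>\<infinity>x\<in>A. f q x) = (\<Sum>\<^sub>\<infinity>x\<in>A. \<Sum>q\<in>Q. f q x)"
    and "(\<lambda>x. \<Sum>q\<in>Q. f q x) summable_on A"
proof -
  have "(\<Sum>q\<in>Q. \<Sum>\<^sub>\<infinity>x\<in>A. f q x) = (\<Sum>\<^sub>\<infinity>x\<in>A. \<Sum>q\<in>Q. f q x)
      \<and> (\<lambda>x. \<Sum>q\<in>Q. f q x) summable_on A"
    using assms by (induction Q) (auto simp: infsum_add intro: summable_on_add)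
  then show "(\<Sum>q\<in>Q. \<Sum>\<^sub>\<infinity>x\<in>A. f q x) = (\<Sum>\<^sub>\<infinity>x\<in>A. \<Sum>q\<in>Q. f q x)"
    and "(\<lambda>x. \<Sum>q\<in>Q. f q x) summable_on A"
    by auto
qed

text \<open>The terms are nonnegative, so both claims come from a bound on finite partial sums: a finite set of
  vectors is contained in a finite box \<open>D\<^sup>u\<close>, over which the sum of products factorises.\<close>

lemma
  fixes f :: "'b \<Rightarrow> real"
  assumes "finite u" and f: "f summable_on B" and nonneg: "\<And>x. x \<in> B \<Longrightarrow> 0 \<le> f x"
  shows summable_on_prod_PiE: "(\<lambda>k. \<Prod>j\<in>u. f (k j)) summable_on (u \<rightarrow>\<^sub>E B)"
    and infsum_prod_PiE_const: "(\<Sum>\<^sub>\<infinity>k\<in>u \<rightarrow>\<^sub>E B. \<Prod>j\<in>u. f (k j)) = (\<Sum>\<^sub>\<infinity>x\<in>B. f x) ^ card u"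
proof -
  have bound: "(\<Sum>k\<in>F. \<Prod>j\<in>u. f (k j)) \<le> (\<Sum>\<^sub>\<infinity>x\<in>B. f x) ^ card u"
    if F: "finite F" "F \<subseteq> u \<rightarrow>\<^sub>E B" for F
  proof -
    define D where "D = (\<lambda>(k, j). k j) ` (F \<times> u)"
    have D: "finite D"
      using F(1) assms(1) by (simp add: D_def)
    have "k j \<in> B" if "k \<in> F" "j \<in> u" for k j
      using F(2) that by (blast dest: PiE_mem)
    then have DB: "D \<subseteq> B"
      by (auto simp: D_def)
    have FD: "F \<subseteq> u \<rightarrow>\<^sub>E D"
    proof
      fix k assume "k \<in> F"
      then have "k \<in> extensional u" "\<And>j. j \<in> u \<Longrightarrow> k j \<in> D"
        using F(2) by (auto simp: D_def PiE_iff intro: rev_image_eqI)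
      then show "k \<in> u \<rightarrow>\<^sub>E D"
        by (simp add: PiE_iff)
    qed
    have nonneg_prod: "0 \<le> (\<Prod>j\<in>u. f (k j))" if "k \<in> u \<rightarrow>\<^sub>E D" for k
      using that DB nonneg by (intro prod_nonneg) (blast dest: PiE_mem)
    have "(\<Sum>k\<in>F. \<Prod>j\<in>u. f (k j)) \<le> (\<Sum>k\<in>u \<rightarrow>\<^sub>E D. \<Prod>j\<in>u. f (k j))"
      using D FD assms(1) nonneg_prod by (intro sum_mono2 finite_PiE) auto
    also have "\<dots> = (\<Sum>x\<in>D. f x) ^ card u"
      using prod_sum_PiE[of u "\<lambda>_. D" "\<lambda>_. f"] D assms(1) by simp
    also have "\<dots> \<le> (\<Sum>\<^sub>\<infinity>x\<in>B. f x) ^ card u"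
    proof (rule power_mono)
      show "(\<Sum>x\<in>D. f x) \<le> (\<Sum>\<^sub>\<infinity>x\<in>B. f x)"
        using D DB nonneg f by (intro finite_sum_le_infsum) auto
      show "0 \<le> (\<Sum>x\<in>D. f x)"
        using DB nonneg by (intro sum_nonneg) auto
    qed
    finally show ?thesis .
  qed
  show summ: "(\<lambda>k. \<Prod>j\<in>u. f (k j)) summable_on (u \<rightarrow>\<^sub>E B)"
  proof (rule nonneg_bdd_above_summable_on)
    show "0 \<le> (\<Prod>j\<in>u. f (k j))" if "k \<in> u \<rightarrow>\<^sub>E B" for k
      using that nonneg by (intro prod_nonneg) (blast dest: PiE_mem)
    show "bdd_above (sum (\<lambda>k. \<Prod>j\<in>u. f (k j)) ` {F. F \<subseteq> u \<rightarrow>\<^sub>E B \<and> finite F})"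
      using bound by (intro bdd_aboveI2) auto
  qed
  show "(\<Sum>\<^sub>\<infinity>k\<in>u \<rightarrow>\<^sub>E B. \<Prod>j\<in>u. f (k j)) = (\<Sum>\<^sub>\<infinity>x\<in>B. f x) ^ card u"
    using infsum_prod_PiE[of u "\<lambda>_. f" "\<lambda>_. B", OF assms(1) f summ]
    by (simp only: prod_constant)
qed

section \<open>The weight of a number and its leading digit\<close>

lemma digit_positions_le:
  assumes "0 < b" "k < b ^ n" "a \<in> digit_positions b k"
  shows "a \<le> n"
proof (rule ccontr)
  assume "\<not> a \<le> n"
  then have "b ^ n \<le> b ^ (a - 1)"
    using assms(1) by (intro power_increasing) auto
  then have "k div b ^ (a - 1) = 0"
    using assms(2) by simp
  then show False
    using assms(3) by (simp add: digit_positions_def digit_def)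
qed

lemma mu_0: "mu b 0 k = 0" "mu b \<alpha> 0 = 0"
  by (simp_all add: mu_def digit_positions_def digit_def)

text \<open>The recursion behind all estimates of \<open>\<mu>\<close>: a leading digit at the zero-based position \<open>n\<close>
  contributes the one-based position \<open>n + 1\<close>, and the remaining digits are weighted with one position
  less.\<close>

lemma mu_add_leading_digit:
  assumes "k < b ^ n" "0 < c" "c < b"
  shows "mu b (Suc \<beta>) (c * b ^ n + k) = Suc n + mu b \<beta> k"
proof -
  have b: "b > 0" using assms by simp
  \<comment> \<open>No carry occurs, because \<open>k\<close> only occupies the positions below \<open>n\<close>.\<close>
  have dig: "digit b (c * b ^ n + k) i = (if i < n then digit b k i else if i = n then c else 0)" for i
  proof -
    consider "i < n" | "i = n" | "i > n" by linarith
    then show ?thesis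
    proof cases
      case 1
      then obtain d where n: "n = i + Suc d"
        using less_imp_Suc_add by auto
      have shift: "c * b ^ n + k = k + (b * (c * b ^ d)) * b ^ i"
        by (simp add: n power_add ac_simps)
      have "(c * b ^ n + k) div b ^ i = b * (c * b ^ d) + k div b ^ i"
        unfolding shift using b by (subst div_mult_self1) auto
      then show ?thesis
        using 1 by (simp add: digit_def)
    next
      case 2
      then show ?thesis using assms by (simp add: digit_def)
    next
      case 3
      have "c * b ^ n + k < Suc c * b ^ n"
        using assms(1) by simp
      also have "\<dots> \<le> b * b ^ n"
        using assms(3) by (intro mult_right_mono) auto
      also have "\<dots> \<le> b ^ i"
        using 3 b power_increasing[of "Suc n" i b] by simp
      finally show ?thesis
        using 3 by (simp add: digit_def)
    qed
  qed
  have high: "digit b k i = 0" if "i \<ge> n" for i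
  proof (rule ccontr)
    assume "digit b k i \<noteq> 0"
    then have "Suc i \<in> digit_positions b k"
      by (simp add: digit_positions_def)
    then show False
      using digit_positions_le[OF b assms(1)] that by fastforce
  qed
  have pos: "digit_positions b (c * b ^ n + k) = insert (Suc n) (digit_positions b k)"
  proof (rule Set.set_eqI)
    fix a
    show "a \<in> digit_positions b (c * b ^ n + k) \<longleftrightarrow> a \<in> insert (Suc n) (digit_positions b k)"
    proof (cases a)
      case (Suc i)
      then show ?thesis
        using assms(2) high[of i] dig[of i] by (simp add: digit_positions_def)
    qed (simp add: digit_positions_def)
  qed
  have fin: "finite (digit_positions b k)"
    using digit_positions_le[OF b assms(1)] by (auto intro!: finite_subset[OF _ finite_atMost[of n]])
  have "sorted_list_of_set (insert (Suc n) (digit_positions b k))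
      = sorted_list_of_set (digit_positions b k) @ [Suc n]"
  proof (rule sorted_distinct_set_unique)
    show "sorted (sorted_list_of_set (digit_positions b k) @ [Suc n])"
      using fin digit_positions_le[OF b assms(1)] by (force simp: sorted_append)
    show "distinct (sorted_list_of_set (digit_positions b k) @ [Suc n])"
      using fin digit_positions_le[OF b assms(1), of "Suc n"] by auto
  qed (use fin in \<open>simp_all del: sorted_list_of_set_insert_remove\<close>)
  then show ?thesis
    by (simp add: mu_def pos)
qed


section \<open>Convergence of the weight series\<close>

text \<open>The numbers below \<open>b\<^sup>n\<^sup>+\<^sup>1\<close> fall into \<open>b\<close> blocks of length \<open>b\<^sup>n\<close> according to their digit at position
  \<open>n\<close>. The block with digit 0 reproduces the previous sum, and the other \<open>b - 1\<close> blocks are treated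
  alike by the recursion for \<open>\<mu>\<close>.\<close>

lemma sum_powr_mu_Suc:
  fixes l :: real
  assumes "b > 0"
  shows "(\<Sum>k<b ^ Suc n. real b powr (- l * mu b (Suc \<beta>) k)) =
           (\<Sum>k<b ^ n. real b powr (- l * mu b (Suc \<beta>) k)) +
           (real b - 1) * real b powr (- l * Suc n) * (\<Sum>k<b ^ n. real b powr (- l * mu b \<beta> k))"
proof -
  define f where "f = (\<lambda>k. real b powr (- l * mu b (Suc \<beta>) k))"
  define g where "g = (\<lambda>k. real b powr (- l * mu b \<beta> k))"
  have block: "(\<Sum>k<b ^ n. f (c * b ^ n + k)) = real b powr (- l * Suc n) * (\<Sum>k<b ^ n. g k)"
    if "c \<in> {1..<b}" for c
  proof -
    have "f (c * b ^ n + k) = real b powr (- l * Suc n) * g k" if "k < b ^ n" for k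
      using mu_add_leading_digit[OF that, of c \<beta>] \<open>c \<in> {1..<b}\<close>
      by (simp add: f_def g_def powr_add[symmetric] algebra_simps)
    then show ?thesis
      by (simp add: sum_distrib_left)
  qed
  have shift: "(\<Sum>k\<in>{c * b ^ n..<c * b ^ n + b ^ n}. f k) = (\<Sum>k<b ^ n. f (c * b ^ n + k))" for c
    by (rule sum.reindex_bij_witness[of _ "\<lambda>k. c * b ^ n + k" "\<lambda>k. k - c * b ^ n"]) auto
  have "(\<Sum>k<b ^ Suc n. f k) = (\<Sum>c<b. \<Sum>k\<in>{c * b ^ n..<c * b ^ n + b ^ n}. f k)"
    by (simp add: sum.nat_group)
  also have "\<dots> = (\<Sum>c<b. \<Sum>k<b ^ n. f (c * b ^ n + k))"
    using shift by simp
  also have "{..<b} = insert 0 {1..<b}"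
    using assms by auto
  also have "(\<Sum>c\<in>insert 0 {1..<b}. \<Sum>k<b ^ n. f (c * b ^ n + k))
      = (\<Sum>k<b ^ n. f k) + (\<Sum>c\<in>{1..<b}. \<Sum>k<b ^ n. f (c * b ^ n + k))"
    by simp
  also have "(\<Sum>c\<in>{1..<b}. \<Sum>k<b ^ n. f (c * b ^ n + k))
      = (\<Sum>c\<in>{1..<b}. real b powr (- l * Suc n) * (\<Sum>k<b ^ n. g k))"
    by (rule sum.cong[OF refl block])
  also have "\<dots> = (real b - 1) * (real b powr (- l * Suc n) * (\<Sum>k<b ^ n. g k))"
    using assms by (simp add: of_nat_diff)
  finally show ?thesis
    by (simp only: f_def g_def mult.assoc)
qed

text \<open>Iterating the block recursion gains a factor \<open>b\<^sup>-\<^sup>l\<^sup>n\<close> for each of the \<open>\<beta>\<close> leading digits, down from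
  the trivial bound \<open>b\<^sup>n\<close> at \<open>\<beta> = 0\<close>. The exponents \<open>1 - \<beta> / \<alpha>\<close> decrease by \<open>1 / \<alpha>\<close> per step, which is
  less than the available \<open>l\<close>. The surplus makes the accumulated constant a partial sum of
  a geometric series, even in steps where using the whole of \<open>l\<close> would produce a factor growing
  with \<open>n\<close>. At \<open>\<beta> = \<alpha>\<close> the exponent is 0 and the bound is uniform in \<open>n\<close>.\<close>

lemma sum_powr_mu_bound:
  fixes l :: real
  assumes "b \<ge> 2" "\<alpha> \<ge> 1" "1 / real \<alpha> < l" "\<beta> \<le> \<alpha>"
  shows "\<exists>C\<ge>0. \<forall>n. (\<Sum>k<b ^ n. real b powr (- l * mu b \<beta> k)) \<le> C * real b powr ((1 - \<beta> / \<alpha>) * n)"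
  using assms(4)
proof (induction \<beta>)
  case 0
  have "(\<Sum>k<b ^ n. real b powr (- l * mu b 0 k)) = real b powr n" for n
    using assms(1) by (simp add: mu_0 powr_realpow)
  then show ?case
    by (intro exI[of _ 1]) simp
next
  case (Suc \<beta>)
  then obtain C where C: "C \<ge> 0"
    "\<And>n. (\<Sum>k<b ^ n. real b powr (- l * mu b \<beta> k)) \<le> C * real b powr ((1 - \<beta> / \<alpha>) * n)"
    by auto
  define e where "e = 1 - real (Suc \<beta>) / \<alpha>"
  \<comment> \<open>The ratio of the geometric series: the surplus of \<open>l\<close> over \<open>1 / \<alpha>\<close>.\<close>
  define r where "r = real b powr (1 / \<alpha> - l)"
  have e: "e \<ge> 0" "1 - \<beta> / \<alpha> = e + 1 / \<alpha>"
    using Suc.prems assms(2) by (simp_all add: e_def field_simps)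
  have l: "l > 0"
    using assms(3) by (meson divide_nonneg_nonneg le_less_trans of_nat_0_le_iff zero_le_one)
  have r: "0 \<le> r" "r < 1"
    using assms(1,3) powr_less_mono[of "1 / \<alpha> - l" 0 "real b"] by (simp_all add: r_def)
  have r_pow: "r ^ n = real b powr ((1 / \<alpha> - l) * n)" for n
    using assms(1) by (simp add: r_def powr_realpow[symmetric] powr_powr)
  have step: "(\<Sum>k<b ^ n. real b powr (- l * mu b (Suc \<beta>) k))
      \<le> (1 + (real b - 1) * C * (\<Sum>i<n. r ^ i)) * real b powr (e * n)" for n
  proof (induction n)
    case 0
    then show ?case using assms(1) by (simp add: mu_0)
  next
    case (Suc n)
    have mono: "real b powr (e * n) \<le> real b powr (e * Suc n)"
      using assms(1) e(1) by (intro powr_mono mult_left_mono) auto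
    have "real b powr (- l * Suc n) * (\<Sum>k<b ^ n. real b powr (- l * mu b \<beta> k))
        \<le> real b powr (- l * Suc n) * (C * real b powr ((e + 1 / \<alpha>) * n))"
      using C(2)[of n] unfolding e(2) by (rule mult_left_mono) simp
    also have "\<dots> = C * real b powr (- l * Suc n + (e + 1 / \<alpha>) * n)"
      by (simp only: powr_add ac_simps)
    also have "\<dots> \<le> C * real b powr ((1 / \<alpha> - l) * n + e * Suc n)"
      using C(1) assms(1) e(1) l
      by (intro mult_left_mono powr_mono) (auto simp: algebra_simps)
    also have "\<dots> = C * r ^ n * real b powr (e * Suc n)"
      by (simp only: powr_add r_pow mult.assoc)
    finally have new: "(real b - 1) * (real b powr (- l * Suc n) * (\<Sum>k<b ^ n. real b powr (- l * mu b \<beta> k)))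
        \<le> (real b - 1) * (C * r ^ n * real b powr (e * Suc n))"
      using assms(1) by (intro mult_left_mono) auto
    have "0 \<le> 1 + (real b - 1) * C * (\<Sum>i<n. r ^ i)"
      using assms(1) C(1) r(1) by (intro add_nonneg_nonneg mult_nonneg_nonneg sum_nonneg) auto
    then have "(\<Sum>k<b ^ n. real b powr (- l * mu b (Suc \<beta>) k))
        \<le> (1 + (real b - 1) * C * (\<Sum>i<n. r ^ i)) * real b powr (e * Suc n)"
      using mono by (intro order_trans[OF Suc.IH] mult_left_mono)
    then have "(\<Sum>k<b ^ Suc n. real b powr (- l * mu b (Suc \<beta>) k))
        \<le> (1 + (real b - 1) * C * (\<Sum>i<n. r ^ i)) * real b powr (e * Suc n)
          + (real b - 1) * (C * r ^ n * real b powr (e * Suc n))"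
      using new assms(1) by (subst sum_powr_mu_Suc) (auto simp only: mult.assoc intro: add_mono)
    also have "\<dots> = (1 + (real b - 1) * C * (\<Sum>i<Suc n. r ^ i)) * real b powr (e * Suc n)"
      by (simp only: sum.lessThan_Suc distrib_left distrib_right mult.assoc add.assoc)
    finally show ?case .
  qed
  have "(\<Sum>k<b ^ n. real b powr (- l * mu b (Suc \<beta>) k))
      \<le> (1 + (real b - 1) * C * (1 / (1 - r))) * real b powr (e * n)" for n
  proof -
    have "(\<Sum>i<n. r ^ i) \<le> 1 / (1 - r)"
      using r sum_le_suminf[of "\<lambda>i. r ^ i" "{..<n}"] by (simp add: suminf_geometric summable_geometric)
    then show ?thesis
      using assms(1) C(1) by (intro order_trans[OF step] mult_right_mono add_left_mono mult_left_mono) auto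
  qed
  then show ?case
    using assms(1) C(1) r unfolding e_def
    by (intro exI[of _ "1 + (real b - 1) * C * (1 / (1 - r))"] conjI allI add_nonneg_nonneg mult_nonneg_nonneg) auto
qed

text \<open>The series defining \<open>E_const\<close> converges because of the bound at \<open>\<beta> = \<alpha>\<close>, which is uniform
  in \<open>n\<close>, so that \<open>E_const\<close> is a genuine sum and not the default value of \<open>infsum\<close>.\<close>

lemma powr_mu_summable_on:
  fixes l :: real
  assumes "b \<ge> 2" "\<alpha> \<ge> 1" "1 / real \<alpha> < l"
  shows "(\<lambda>k. real b powr (- l * mu b \<alpha> k)) summable_on A"
proof -
  obtain C where C: "\<And>n. (\<Sum>k<b ^ n. real b powr (- l * mu b \<alpha> k)) \<le> C"
    using sum_powr_mu_bound[OF assms order_refl] assms(2) assms(1) by auto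
  have "(\<lambda>k. real b powr (- l * mu b \<alpha> k)) summable_on UNIV"
  proof (rule nonneg_bdd_above_summable_on)
    show "bdd_above (sum (\<lambda>k. real b powr (- l * mu b \<alpha> k)) ` {F. F \<subseteq> UNIV \<and> finite F})"
    proof (rule bdd_aboveI2)
      fix F :: "nat set"
      assume "F \<in> {F. F \<subseteq> UNIV \<and> finite F}"
      then obtain n where "F \<subseteq> {..n}"
        using finite_nat_iff_bounded_le by auto
      moreover have "n < b ^ n"
        using assms(1) by (intro power_gt_expt) auto
      ultimately have "F \<subseteq> {..<b ^ n}"
        by auto
      then have "(\<Sum>k\<in>F. real b powr (- l * mu b \<alpha> k)) \<le> (\<Sum>k<b ^ n. real b powr (- l * mu b \<alpha> k))"
        by (intro sum_mono2) auto
      also have "\<dots> \<le> C" by (rule C)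
      finally show "(\<Sum>k\<in>F. real b powr (- l * mu b \<alpha> k)) \<le> C" .
    qed
  qed simp
  then show ?thesis
    by (rule summable_on_subset_banach) simp
qed


section \<open>Averaging over the generating vectors\<close>

text \<open>The range of the inner sum of \<open>B_crit\<close>: the part of the dual lattice that actually depends on the
  generating vector. Vectors all of whose entries are multiples of \<open>b\<^sup>m\<close> truncate to 0 and belong to
  every dual lattice.\<close>

abbreviation dual_non_multiples ::
  "nat \<Rightarrow> nat set \<Rightarrow> 'b::prime_card mod_ring poly \<Rightarrow> (nat \<Rightarrow> 'b mod_ring poly) \<Rightarrow> (nat \<Rightarrow> nat) set" where
  "dual_non_multiples s u p q \<equiv>
     {k \<in> dual_lattice_proj s u p q. \<exists>j\<in>u. \<not> CARD('b) ^ degree p dvd k j}"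

lemma mem_dual_lattice_proj_iff:
  "k \<in> dual_lattice_proj s u p q \<longleftrightarrow> k \<in> u \<rightarrow>\<^sub>E {1..} \<and>
     p dvd (\<Sum>i\<in>{1..s}. tr (degree p) (if i \<in> u then k i else 0) * q i)"
proof -
  have "(\<Sum>i=1..s. tr (degree p) ((\<lambda>i\<in>{1..s}. if i \<in> u then k i else 0) i) * q i)
      = (\<Sum>i\<in>{1..s}. tr (degree p) (if i \<in> u then k i else 0) * q i)"
    by (rule sum.cong) simp_all
  then show ?thesis
    unfolding dual_lattice_proj_def dual_lattice_def mem_Collect_eq cong_0_iff
    by (simp only: restrict_PiE_iff UNIV_I Ball_def simp_thms)
qed

text \<open>A coordinate \<open>k j\<close> that is not a multiple of \<open>b\<^sup>m\<close> truncates to a nonzero polynomial of degree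
  below \<open>m\<close>, which is coprime to the irreducible \<open>p\<close>. So \<open>k\<close> is dual to at most a fraction
  \<open>1 / card (G_star m)\<close> of all generating vectors.\<close>

lemma card_dual_vectors_mult_le:
  fixes p :: "'b::prime_card mod_ring poly"
  assumes "irreducible p" "u \<subseteq> {1..s}"
  shows "card {q \<in> {1..s} \<rightarrow>\<^sub>E G_star (degree p). k \<in> dual_non_multiples s u p q}
           * card (G_star (degree p) :: 'b mod_ring poly set)
         \<le> card (G_star (degree p) :: 'b mod_ring poly set) ^ s"
proof (cases "\<exists>j\<in>u. \<not> CARD('b) ^ degree p dvd k j")
  case True
  define G where "G = (G_star (degree p) :: 'b mod_ring poly set)"
  define t where "t = (\<lambda>i. tr (degree p) (if i \<in> u then k i else 0) :: 'b mod_ring poly)"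
  obtain j where j: "j \<in> u" "\<not> CARD('b) ^ degree p dvd k j"
    using True by blast
  have G: "finite G" "G \<subseteq> G_poly (degree p)"
    using finite_G_poly by (auto simp: G_def G_star_def)
  have "\<not> p dvd t j"
  proof
    assume "p dvd t j"
    moreover have "0 \<in> G_poly (degree p)"
      by (simp add: G_poly_def)
    moreover have "t j \<in> G_poly (degree p)"
      by (simp only: t_def tr_in_G_poly)
    ultimately have "t j = 0"
      using eq_if_dvd_diff_G_poly[of "t j" p 0] by simp
    then show False
      using tr_eq_0D[where 'b = 'b, of "degree p" "k j"] j by (simp add: t_def)
  qed
  then have "card {q \<in> {1..s} \<rightarrow>\<^sub>E G. p dvd (\<Sum>i\<in>{1..s}. t i * q i)} * card G \<le> card G ^ card {1..s}"
    using j(1) assms G eq_if_dvd_diff_G_poly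
    by (intro card_orthogonal_mult_le[where j = j] field_poly_irreducible_imp_prime) blast+
  moreover have "card {q \<in> {1..s} \<rightarrow>\<^sub>E G. k \<in> dual_non_multiples s u p q}
      \<le> card {q \<in> {1..s} \<rightarrow>\<^sub>E G. p dvd (\<Sum>i\<in>{1..s}. t i * q i)}"
  proof (rule card_mono)
    show "finite {q \<in> {1..s} \<rightarrow>\<^sub>E G. p dvd (\<Sum>i\<in>{1..s}. t i * q i)}"
      using G(1) by (simp add: finite_PiE)
  qed (auto simp: mem_dual_lattice_proj_iff t_def)
  ultimately show ?thesis
    unfolding G_def by (simp del: mem_Collect_eq) (meson le_trans mult_le_mono1)
next
  case False
  then have "{q \<in> {1..s} \<rightarrow>\<^sub>E G_star (degree p). k \<in> dual_non_multiples s u p q} = {}"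
    by blast
  then show ?thesis by (simp only: card.empty)
qed

text \<open>Double counting: after exchanging the two sums, each \<open>h k\<close> is counted once for every generating
  vector to which \<open>k\<close> is dual.\<close>

lemma sum_infsum_dual_le:
  fixes p :: "'b::prime_card mod_ring poly" and h :: "(nat \<Rightarrow> nat) \<Rightarrow> real"
  assumes "irreducible p" "u \<subseteq> {1..s}"
    and h: "h summable_on (u \<rightarrow>\<^sub>E {1..})" and nonneg: "\<And>k. 0 \<le> h k"
  defines "N \<equiv> real (card (G_star (degree p) :: 'b mod_ring poly set))"
  shows "N * (\<Sum>q\<in>{1..s} \<rightarrow>\<^sub>E G_star (degree p). \<Sum>\<^sub>\<infinity>k\<in>dual_non_multiples s u p q. h k)
           \<le> N ^ s * (\<Sum>\<^sub>\<infinity>k\<in>u \<rightarrow>\<^sub>E {1..}. h k)"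
proof -
  let ?Q = "{1..s} \<rightarrow>\<^sub>E (G_star (degree p) :: 'b mod_ring poly set)"
  let ?K = "u \<rightarrow>\<^sub>E {1::nat..}"
  define g where "g = (\<lambda>q k. if k \<in> dual_non_multiples s u p q then h k else 0)"
  have Q: "finite ?Q"
    using finite_G_poly by (intro finite_PiE) (auto simp: G_star_def)
  have sub: "dual_non_multiples s u p q \<subseteq> ?K" for q
    by (auto simp: mem_dual_lattice_proj_iff)
  have g_summ: "g q summable_on ?K" for q
  proof -
    have "h summable_on dual_non_multiples s u p q"
      using h sub by (rule summable_on_subset_banach)
    then show ?thesis
      using sub by (subst summable_on_cong_neutral[where g = h and T = "dual_non_multiples s u p q"])
        (auto simp: g_def)
  qed
  have "(\<Sum>\<^sub>\<infinity>k\<in>dual_non_multiples s u p q. h k) = (\<Sum>\<^sub>\<infinity>k\<in>?K. g q k)" for q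
    using sub by (intro infsum_cong_neutral) (auto simp: g_def)
  then have "N * (\<Sum>q\<in>?Q. \<Sum>\<^sub>\<infinity>k\<in>dual_non_multiples s u p q. h k)
      = N * (\<Sum>\<^sub>\<infinity>k\<in>?K. \<Sum>q\<in>?Q. g q k)"
    using sum_infsum_swap(1)[OF Q, of g ?K] g_summ by simp
  also have "\<dots> = (\<Sum>\<^sub>\<infinity>k\<in>?K. N * (\<Sum>q\<in>?Q. g q k))"
    by (simp only: infsum_cmult_right')
  also have "\<dots> \<le> (\<Sum>\<^sub>\<infinity>k\<in>?K. N ^ s * h k)"
  proof (rule infsum_mono)
    show "(\<lambda>k. N * (\<Sum>q\<in>?Q. g q k)) summable_on ?K"
      using sum_infsum_swap(2)[OF Q, of g ?K] g_summ by (intro summable_on_cmult_right) auto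
    show "(\<lambda>k. N ^ s * h k) summable_on ?K"
      using h by (rule summable_on_cmult_right)
    fix k
    have "(\<Sum>q\<in>?Q. g q k) = real (card {q \<in> ?Q. k \<in> dual_non_multiples s u p q}) * h k"
      unfolding g_def using Q by (subst sum.inter_filter[symmetric]) simp_all
    then have "N * (\<Sum>q\<in>?Q. g q k)
        = real (card {q \<in> ?Q. k \<in> dual_non_multiples s u p q} * card (G_star (degree p) :: 'b mod_ring poly set)) * h k"
      by (simp only: N_def of_nat_mult ac_simps)
    also have "\<dots> \<le> N ^ s * h k"
      unfolding N_def of_nat_power[symmetric]
      using card_dual_vectors_mult_le[OF assms(1,2)] nonneg
      by (intro mult_right_mono of_nat_mono) auto
    finally show "N * (\<Sum>q\<in>?Q. g q k) \<le> N ^ s * h k" .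
  qed
  also have "\<dots> = N ^ s * (\<Sum>\<^sub>\<infinity>k\<in>?K. h k)"
    by (simp only: infsum_cmult_right')
  finally show ?thesis .
qed

lemma powr_mu_vec_eq_prod:
  fixes l :: real
  assumes "b > 0" "finite u"
  shows "real b powr (- l * mu_vec b \<alpha> u k) = (\<Prod>j\<in>u. real b powr (- l * mu b \<alpha> (k j)))"
  using assms by (simp add: mu_vec_def powr_sum[symmetric] sum_distrib_left)

lemma
  fixes l :: real
  assumes "b \<ge> 2" "\<alpha> \<ge> 1" "1 / real \<alpha> < l" "finite u"
  shows powr_mu_vec_summable_on:
      "(\<lambda>k. real b powr (- l * mu_vec b \<alpha> u k)) summable_on (u \<rightarrow>\<^sub>E {1..})"
    and infsum_powr_mu_vec:
      "(\<Sum>\<^sub>\<infinity>k\<in>u \<rightarrow>\<^sub>E {1..}. real b powr (- l * mu_vec b \<alpha> u k)) = E_const b \<alpha> l ^ card u"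
proof -
  have b: "b > 0" using assms(1) by simp
  note summ = powr_mu_summable_on[OF assms(1-3), of "{1..}"]
  show "(\<lambda>k. real b powr (- l * mu_vec b \<alpha> u k)) summable_on (u \<rightarrow>\<^sub>E {1..})"
    unfolding powr_mu_vec_eq_prod[OF b assms(4)]
    by (rule summable_on_prod_PiE[OF assms(4) summ]) simp
  show "(\<Sum>\<^sub>\<infinity>k\<in>u \<rightarrow>\<^sub>E {1..}. real b powr (- l * mu_vec b \<alpha> u k)) = E_const b \<alpha> l ^ card u"
    unfolding powr_mu_vec_eq_prod[OF b assms(4)] E_const_def
    by (rule infsum_prod_PiE_const[OF assms(4) summ]) simp
qed

lemma C_const_nonneg:
  assumes "b \<ge> 2"
  shows "0 \<le> C_const b \<alpha>"
proof -
  have "0 < pi / real b" "pi / real b < pi"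
    using assms by (simp_all add: divide_less_eq)
  then have "0 < sin (pi / real b)"
    by (rule sin_gt_zero)
  then have "0 \<le> 2 / (2 * sin (pi / real b)) ^ \<alpha>"
    by simp
  then show ?thesis
    unfolding C_const_def using assms
    by (intro mult_nonneg_nonneg max.coboundedI1 zero_le_power add_nonneg_nonneg divide_nonneg_nonneg) auto
qed

lemma B_crit_nonneg:
  fixes p :: "'b::prime_card mod_ring poly"
  assumes "\<And>u. \<gamma> u \<ge> 0"
  shows "0 \<le> B_crit s \<alpha> \<gamma> p q"
proof -
  have "CARD('b) \<ge> 2"
    using prime_card prime_ge_2_nat by blast
  then show ?thesis
    unfolding B_crit_def using assms C_const_nonneg
    by (intro sum_nonneg mult_nonneg_nonneg infsum_nonneg zero_le_power) auto
qed

text \<open>Subadditivity of \<open>x \<mapsto> x\<^sup>l\<close> is used twice, for the outer sum over \<open>u\<close> and for the inner sum over the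
  dual lattice.\<close>

lemma B_crit_powr_le:
  fixes p :: "'b::prime_card mod_ring poly"
  assumes "\<alpha> \<ge> 1" "1 / real \<alpha> < l" "l \<le> 1" and \<gamma>: "\<And>u. \<gamma> u \<ge> 0"
  shows "B_crit s \<alpha> \<gamma> p q powr l \<le>
    (\<Sum>u\<in>Pow {1..s} - {{}}. \<gamma> u powr l * C_const CARD('b) \<alpha> powr (l * card u)
       * (\<Sum>\<^sub>\<infinity>k\<in>dual_non_multiples s u p q. real CARD('b) powr (- l * mu_vec CARD('b) \<alpha> u k)))"
proof -
  let ?b = "CARD('b)"
  let ?C = "C_const ?b \<alpha>"
  let ?S = "\<lambda>u. \<Sum>\<^sub>\<infinity>k\<in>dual_non_multiples s u p q. real ?b powr (- real (mu_vec ?b \<alpha> u k))"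
  let ?T = "\<lambda>u. \<Sum>\<^sub>\<infinity>k\<in>dual_non_multiples s u p q. real ?b powr (- l * mu_vec ?b \<alpha> u k)"
  have b: "?b \<ge> 2"
    using prime_card prime_ge_2_nat by blast
  have l: "0 < l"
    using assms(2) by (meson divide_nonneg_nonneg le_less_trans of_nat_0_le_iff zero_le_one)
  have C: "0 \<le> ?C"
    using b by (rule C_const_nonneg)
  have S: "0 \<le> ?S u" for u
    by (intro infsum_nonneg) simp
  have "B_crit s \<alpha> \<gamma> p q powr l \<le> (\<Sum>u\<in>Pow {1..s} - {{}}. (\<gamma> u * ?C ^ card u * ?S u) powr l)"
    unfolding B_crit_def using l assms(3) \<gamma> C S
    by (intro sum_powr_le mult_nonneg_nonneg zero_le_power) auto
  also have "\<dots> \<le> (\<Sum>u\<in>Pow {1..s} - {{}}. \<gamma> u powr l * ?C powr (l * card u) * ?T u)"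
  proof (rule sum_mono)
    fix u
    assume u: "u \<in> Pow {1..s} - {{}}"
    then have fin: "finite u"
      by (auto intro: finite_subset)
    have "(\<lambda>k. real ?b powr (- l * mu_vec ?b \<alpha> u k)) summable_on dual_non_multiples s u p q"
      using powr_mu_vec_summable_on[OF b assms(1,2) fin]
      by (rule summable_on_subset_banach) (auto simp: mem_dual_lattice_proj_iff)
    then have "?S u powr l \<le> ?T u"
      using infsum_powr_le[OF l assms(3), of "dual_non_multiples s u p q"
          "\<lambda>k. real ?b powr (- real (mu_vec ?b \<alpha> u k))"]
      by (simp add: powr_powr mult.commute)
    moreover have "(?C ^ card u) powr l = ?C powr (l * card u)"
    proof (cases "?C = 0")
      case True
      \<comment> \<open>For \<open>u = {}\<close> the claim would fail here, since \<open>0 powr 0 = 0\<close> while \<open>0 ^ 0 = 1\<close>.\<close>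
      have "card u > 0"
        using u fin by (auto simp: card_gt_0_iff)
      then show ?thesis
        using True by (simp add: zero_power)
    next
      case False
      then show ?thesis
        using C by (simp add: powr_realpow[symmetric] powr_powr mult.commute)
    qed
    ultimately show "(\<gamma> u * ?C ^ card u * ?S u) powr l \<le> \<gamma> u powr l * ?C powr (l * card u) * ?T u"
      using \<gamma> C S by (simp add: powr_mult mult_left_mono)
  qed
  finally show ?thesis .
qed

text \<open>The mean value of \<open>B\<^sup>l\<close> over all \<open>N\<^sup>s\<close> generating vectors is at most \<open>1 / N\<close> times the bracket in
  the theorem. Dropping the duality condition gains the factor \<open>1 / N\<close>, after which the unrestricted sum over
  \<open>k\<close> is a power of \<open>E_const\<close>.\<close>

lemma sum_B_crit_powr_le:
  fixes p :: "'b::prime_card mod_ring poly"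
  assumes "irreducible p" "\<alpha> \<ge> 1" "1 / real \<alpha> < l" "l \<le> 1" and \<gamma>: "\<And>u. \<gamma> u \<ge> 0"
  defines "N \<equiv> real (card (G_star (degree p) :: 'b mod_ring poly set))"
  shows "N * (\<Sum>q\<in>{1..s} \<rightarrow>\<^sub>E G_star (degree p). B_crit s \<alpha> \<gamma> p q powr l)
    \<le> N ^ s * (\<Sum>u\<in>Pow {1..s} - {{}}. \<gamma> u powr l * C_const CARD('b) \<alpha> powr (l * card u)
                 * E_const CARD('b) \<alpha> l ^ card u)"
proof -
  let ?Q = "{1..s} \<rightarrow>\<^sub>E (G_star (degree p) :: 'b mod_ring poly set)"
  let ?w = "\<lambda>u. \<gamma> u powr l * C_const CARD('b) \<alpha> powr (l * card u)"
  let ?T = "\<lambda>u q. \<Sum>\<^sub>\<infinity>k\<in>dual_non_multiples s u p q. real CARD('b) powr (- l * mu_vec CARD('b) \<alpha> u k)"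
  have b: "CARD('b) \<ge> 2"
    using prime_card prime_ge_2_nat by blast
  have "N * (\<Sum>q\<in>?Q. B_crit s \<alpha> \<gamma> p q powr l)
      \<le> N * (\<Sum>q\<in>?Q. \<Sum>u\<in>Pow {1..s} - {{}}. ?w u * ?T u q)"
    using assms by (intro mult_left_mono sum_mono B_crit_powr_le) auto
  also have "\<dots> = (\<Sum>u\<in>Pow {1..s} - {{}}. ?w u * (N * (\<Sum>q\<in>?Q. ?T u q)))"
    by (subst sum.swap) (simp only: sum_distrib_left mult.left_commute)
  also have "\<dots> \<le> (\<Sum>u\<in>Pow {1..s} - {{}}. ?w u * (N ^ s * E_const CARD('b) \<alpha> l ^ card u))"
  proof (intro sum_mono mult_left_mono)
    fix u
    assume "u \<in> Pow {1..s} - {{}}"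
    then have u: "u \<subseteq> {1..s}" and fin: "finite u"
      by (auto intro: finite_subset)
    show "N * (\<Sum>q\<in>?Q. ?T u q) \<le> N ^ s * E_const CARD('b) \<alpha> l ^ card u"
      using sum_infsum_dual_le[OF assms(1) u powr_mu_vec_summable_on[OF b assms(2,3) fin]]
      by (simp only: N_def infsum_powr_mu_vec[OF b assms(2,3) fin] powr_ge_zero)
  qed simp
  also have "\<dots> = N ^ s * (\<Sum>u\<in>Pow {1..s} - {{}}. ?w u * E_const CARD('b) \<alpha> l ^ card u)"
    by (simp only: sum_distrib_left mult.left_commute)
  finally show ?thesis .
qed

theorem theorem3:
  fixes b \<alpha> s m :: nat
    and p :: "'b::prime_card mod_ring poly"
    and \<gamma> :: "nat set \<Rightarrow> real"
  assumes "prime b" and "CARD('b) = b"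
    and "\<alpha> \<ge> 2" and "s \<ge> 1" and "m \<ge> 1"
    and "degree p = m" and "irreducible p"
    and "\<And>u. \<gamma> u \<ge> 0"
  shows "\<exists>q \<in> {1..s} \<rightarrow>\<^sub>E G_star m. \<forall>l::real. 1 / real \<alpha> < l \<and> l \<le> 1 \<longrightarrow>
           B_crit s \<alpha> \<gamma> p q \<le>
             1 / (real b ^ m - 1) powr (1 / l) *
             (\<Sum>u\<in>Pow {1..s} - {{}}. \<gamma> u powr l * C_const b \<alpha> powr (l * real (card u))
                 * E_const b \<alpha> l ^ card u) powr (1 / l)"
proof -
  let ?Q = "{1..s} \<rightarrow>\<^sub>E (G_star m :: 'b mod_ring poly set)"
  define N where "N = real (card (G_star m :: 'b mod_ring poly set))"
  have "b ^ 1 \<le> b ^ m"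
    using assms(5) prime_gt_0_nat[OF assms(1)] by (intro power_increasing) auto
  then have bm: "b ^ m \<ge> 2"
    using prime_ge_2_nat[OF assms(1)] by simp
  have N: "real b ^ m - 1 \<le> N"
    using of_nat_mono[OF card_G_star_ge[where 'b = 'b and m = m], where 'a = real] bm assms(2)
    by (simp add: N_def of_nat_diff)
  moreover have bm_real: "real b ^ m - 1 > 0"
    using bm by (metis of_nat_power one_less_numeral_iff semiring_norm(76) diff_gt_0_iff_gt
        less_le_trans of_nat_1 of_nat_less_iff nat_1_add_1 one_add_one less_add_one)
  ultimately have N_pos: "N > 0"
    by simp
  have Q_fin: "finite ?Q"
    using finite_G_poly by (intro finite_PiE) (auto simp: G_star_def)
  have Q_card: "real (card ?Q) = N ^ s"
    by (simp add: card_funcsetE N_def)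
  then have "?Q \<noteq> {}"
    using N_pos by (metis card.empty of_nat_0 power_not_zero less_irrefl)
  \<comment> \<open>The minimiser is chosen before \<open>l\<close>, so one vector serves all \<open>l\<close>.\<close>
  then obtain q where q: "q \<in> ?Q" "\<And>q'. q' \<in> ?Q \<Longrightarrow> B_crit s \<alpha> \<gamma> p q \<le> B_crit s \<alpha> \<gamma> p q'"
    using Q_fin ex_is_arg_min_if_finite[of ?Q "B_crit s \<alpha> \<gamma> p"]
    by (auto simp: is_arg_min_linorder)
  have "B_crit s \<alpha> \<gamma> p q \<le>
             1 / (real b ^ m - 1) powr (1 / l) *
             (\<Sum>u\<in>Pow {1..s} - {{}}. \<gamma> u powr l * C_const b \<alpha> powr (l * real (card u))
                 * E_const b \<alpha> l ^ card u) powr (1 / l)"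
    if l: "1 / real \<alpha> < l" "l \<le> 1" for l :: real
  proof -
    define B where "B = B_crit s \<alpha> \<gamma> p q"
    define W where "W = (\<Sum>u\<in>Pow {1..s} - {{}}. \<gamma> u powr l * C_const b \<alpha> powr (l * real (card u))
                 * E_const b \<alpha> l ^ card u)"
    have l_pos: "0 < l"
      using l(1) by (meson divide_nonneg_nonneg le_less_trans of_nat_0_le_iff zero_le_one)
    have B: "0 \<le> B"
      using assms(8) by (simp add: B_def B_crit_nonneg)
    have "N * (N ^ s * B powr l) = N * (\<Sum>q'\<in>?Q. B powr l)"
      using Q_card by simp
    also have "\<dots> \<le> N * (\<Sum>q'\<in>?Q. B_crit s \<alpha> \<gamma> p q' powr l)"
      using N_pos B l_pos q(2) unfolding B_def
      by (intro mult_left_mono sum_mono powr_mono2) auto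
    also have "\<dots> \<le> N ^ s * W"
      using sum_B_crit_powr_le[OF assms(7) _ l assms(8)] assms(2,3,6) by (simp add: W_def N_def)
    finally have NB: "N * B powr l \<le> W"
      using N_pos by (simp add: mult.left_commute)
    have "(real b ^ m - 1) * B powr l \<le> N * B powr l"
      using N by (rule mult_right_mono) simp
    with NB have "B powr l \<le> W / (real b ^ m - 1)"
      using bm_real by (simp add: pos_le_divide_eq mult.commute)
    then have "(B powr l) powr (1 / l) \<le> (W / (real b ^ m - 1)) powr (1 / l)"
      using l_pos by (intro powr_mono2) auto
    moreover have "(B powr l) powr (1 / l) = B"
      using B l_pos by (simp add: powr_powr)
    moreover have "0 \<le> W"
      using NB N_pos by (meson mult_nonneg_nonneg order_trans less_imp_le powr_ge_zero)
    ultimately show ?thesis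
      using bm_real by (simp add: B_def W_def powr_divide)
  qed
  then show ?thesis
    using q(1) by blast
qed

end
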